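(* Let $(\mathbf{A},\mathbf{B},a,b,\varphi)$ be a gluing datum. Then the algebra $\mathbf{A} \oplus_\varphi \mathbf{B}$ is a member of $\mathsf{CIdInRL}$.
   Context: A commutative idempotent involutive residuated lattice is an algebra $\mathbf{A}=\langle A,\wedge,\vee,\cdot,\to,1,0\rangle$ such that $\langle A,\wedge,\vee\rangle$ is a lattice (with lattice order $\leq$), $\langle A,\cdot,1\rangle$ is a commutative monoid with $x\cdot x=x$ for all $x$, residuation holds ($x\cdot y\leq z \iff y\leq x\to z$), and, writing $-x := x\to 0$, one has $-{-}x=x$ for all $x$. The class of these algebras is $\mathsf{CIdInRL}$. The monoidal order is $x\sqsubseteq y :\Leftrightarrow x\cdot y=x$. Put $0_x := x\wedge -x$ and $A^- := \{x\in A\mid x\leq 1\}$ (negative cone). Gluing datum: $\mathbf{A},\mathbf{B}\in\mathsf{CIdInRL}$ with $A\cap B=\emptyset$ (operations and orders superscripted by $A$, $B$); an element $a\in A^-$ with $a\nleq 0^A$; an element $b\in B^-$; and a bijection $\varphi\colon\{x\in A\mid a\sqsubseteq^A x\}\to\{y\in B\mid y\sqsubseteq^B b\}$ such that $\varphi(x\cdot^A y)=\varphi(x)\cdot^B\varphi(y)$ and $\varphi(x\vee^A y)=\varphi(x)\vee^B\varphi(y)$ for all $x,y$ in its domain, and $0_b=\varphi(a\vee^A 0^A)$, where $0_b = b\wedge^B -^B b$. (The domain of $\varphi$ is closed under $\cdot^A,\vee^A$ and contains $a\vee^A 0^A$.) The gluing $\mathbf{A}\oplus_\varphi\mathbf{B}$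 has universe $A\cup B$, constants $0=0^B$, $1=1^B$, involution $-x=-^A x$ for $x\in A$ and $-x=-^B x$ for $x\in B$, and operations: $x\cdot y=x\cdot^A y$ if $x,y\in A$; $x\cdot y=x\cdot^B y$ if $x,y\in B$; $x\cdot y=y\cdot x=x\cdot^A\varphi^{-1}(y\cdot^B b)$ if $x\in A$, $y\in B$. Further $x\vee y=x\vee^A y$ if $x,y\in A$; $x\vee y=x\vee^B y$ if $x,y\in B$; and for $x\in A$, $y\in B$: $x\vee y=y\vee x=\varphi(x\vee^A a)\vee^B y$ if $x\leq^A -^A a$, and $x\vee y=y\vee x=x\vee^A\varphi^{-1}(y\cdot^B b)$ if $x\nleq^A -^A a$. Finally $x\to y := -(-y\cdot x)$ and $x\wedge y := -(-x\vee -y)$. *)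

theory Defs
  imports "HOL-Algebra.Group"
begin

record 'a rlat = "'a monoid" +
  rmeet :: "'a \<Rightarrow> 'a \<Rightarrow> 'a" (infixl "\<curlywedge>\<index>" 70)
  rjoin :: "'a \<Rightarrow> 'a \<Rightarrow> 'a" (infixl "\<curlyvee>\<index>" 65)
  rimp :: "'a \<Rightarrow> 'a \<Rightarrow> 'a" (infixr "\<leadsto>\<index>" 60)
  rzero :: 'a ("\<bbbO>\<index>")

definition rleq :: "('a, 'm) rlat_scheme \<Rightarrow> 'a \<Rightarrow> 'a \<Rightarrow> bool" (infix "\<preceq>\<index>" 50)
  where "x \<preceq>\<^bsub>R\<^esub> y \<longleftrightarrow> x \<curlywedge>\<^bsub>R\<^esub> y = x"

definition mleq :: "('a, 'm) rlat_scheme \<Rightarrow> 'a \<Rightarrow> 'a \<Rightarrow> bool" (infix "\<unlhd>\<index>" 50)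
  where "x \<unlhd>\<^bsub>R\<^esub> y \<longleftrightarrow> x \<otimes>\<^bsub>R\<^esub> y = x"

definition rneg :: "('a, 'm) rlat_scheme \<Rightarrow> 'a \<Rightarrow> 'a" ("\<sim>\<index> _" [81] 80)
  where "\<sim>\<^bsub>R\<^esub> x = x \<leadsto>\<^bsub>R\<^esub> \<bbbO>\<^bsub>R\<^esub>"

definition zero_at :: "('a, 'm) rlat_scheme \<Rightarrow> 'a \<Rightarrow> 'a"
  where "zero_at R x = x \<curlywedge>\<^bsub>R\<^esub> (\<sim>\<^bsub>R\<^esub> x)"

definition neg_cone :: "('a, 'm) rlat_scheme \<Rightarrow> 'a set"
  where "neg_cone R = {x \<in> carrier R. x \<preceq>\<^bsub>R\<^esub> \<one>\<^bsub>R\<^esub>}"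

(* Lattices are presented equationally, as algebras with two operations; the lattice locale
   of HOL-Algebra is based on a primitive order relation instead. *)
locale CIdInRL = comm_monoid R for R :: "('a, 'm) rlat_scheme" (structure) +
  assumes meet_closed: "\<lbrakk>x \<in> carrier R; y \<in> carrier R\<rbrakk> \<Longrightarrow> x \<curlywedge> y \<in> carrier R"
    and join_closed: "\<lbrakk>x \<in> carrier R; y \<in> carrier R\<rbrakk> \<Longrightarrow> x \<curlyvee> y \<in> carrier R"
    and imp_closed: "\<lbrakk>x \<in> carrier R; y \<in> carrier R\<rbrakk> \<Longrightarrow> x \<leadsto> y \<in> carrier R"
    and zero_closed: "\<bbbO> \<in> carrier R"
    and meet_comm: "\<lbrakk>x \<in> carrier R; y \<in> carrier R\<rbrakk> \<Longrightarrow> x \<curlywedge> y = y \<curlywedge> x"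
    and join_comm: "\<lbrakk>x \<in> carrier R; y \<in> carrier R\<rbrakk> \<Longrightarrow> x \<curlyvee> y = y \<curlyvee> x"
    and meet_assoc: "\<lbrakk>x \<in> carrier R; y \<in> carrier R; z \<in> carrier R\<rbrakk>
      \<Longrightarrow> (x \<curlywedge> y) \<curlywedge> z = x \<curlywedge> (y \<curlywedge> z)"
    and join_assoc: "\<lbrakk>x \<in> carrier R; y \<in> carrier R; z \<in> carrier R\<rbrakk>
      \<Longrightarrow> (x \<curlyvee> y) \<curlyvee> z = x \<curlyvee> (y \<curlyvee> z)"
    and meet_join_absorb: "\<lbrakk>x \<in> carrier R; y \<in> carrier R\<rbrakk> \<Longrightarrow> x \<curlywedge> (x \<curlyvee> y) = x"
    and join_meet_absorb: "\<lbrakk>x \<in> carrier R; y \<in> carrier R\<rbrakk> \<Longrightarrow> x \<curlyvee> (x \<curlywedge> y) = x"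
    and mult_idem: "x \<in> carrier R \<Longrightarrow> x \<otimes> x = x"
    and residuation: "\<lbrakk>x \<in> carrier R; y \<in> carrier R; z \<in> carrier R\<rbrakk>
      \<Longrightarrow> x \<otimes> y \<preceq> z \<longleftrightarrow> y \<preceq> x \<leadsto> z"
    and neg_neg: "x \<in> carrier R \<Longrightarrow> \<sim> (\<sim> x) = x"

definition glue_dom :: "('a, 'm) rlat_scheme \<Rightarrow> 'a \<Rightarrow> 'a set"
  where "glue_dom A a = {x \<in> carrier A. a \<unlhd>\<^bsub>A\<^esub> x}"

definition glue_cod :: "('a, 'm) rlat_scheme \<Rightarrow> 'a \<Rightarrow> 'a set"
  where "glue_cod B b = {y \<in> carrier B. y \<unlhd>\<^bsub>B\<^esub> b}"

locale gluing_datum = A: CIdInRL A + B: CIdInRL B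
  for A :: "'a rlat" and B :: "'a rlat" +
  fixes a b :: 'a and \<phi> :: "'a \<Rightarrow> 'a"
  assumes disjoint: "carrier A \<inter> carrier B = {}"
    and a_neg: "a \<in> neg_cone A"
    and a_not_below_zero: "\<not> a \<preceq>\<^bsub>A\<^esub> \<bbbO>\<^bsub>A\<^esub>"
    and b_neg: "b \<in> neg_cone B"
    and phi_bij: "bij_betw \<phi> (glue_dom A a) (glue_cod B b)"
    and phi_mult: "\<lbrakk>x \<in> glue_dom A a; y \<in> glue_dom A a\<rbrakk>
      \<Longrightarrow> \<phi> (x \<otimes>\<^bsub>A\<^esub> y) = \<phi> x \<otimes>\<^bsub>B\<^esub> \<phi> y"
    and phi_join: "\<lbrakk>x \<in> glue_dom A a; y \<in> glue_dom A a\<rbrakk>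
      \<Longrightarrow> \<phi> (x \<curlyvee>\<^bsub>A\<^esub> y) = \<phi> x \<curlyvee>\<^bsub>B\<^esub> \<phi> y"
    and zero_at_b: "zero_at B b = \<phi> (a \<curlyvee>\<^bsub>A\<^esub> \<bbbO>\<^bsub>A\<^esub>)"

(* In the operations below, arguments outside carrier A are treated as elements of carrier B;
   values at arguments outside both carriers are irrelevant. *)

definition glue_neg :: "'a rlat \<Rightarrow> 'a rlat \<Rightarrow> 'a \<Rightarrow> 'a"
  where "glue_neg A B x = (if x \<in> carrier A then \<sim>\<^bsub>A\<^esub> x else \<sim>\<^bsub>B\<^esub> x)"

definition glue_mult_AB :: "'a rlat \<Rightarrow> 'a rlat \<Rightarrow> 'a \<Rightarrow> 'a \<Rightarrow> ('a \<Rightarrow> 'a) \<Rightarrow> 'a \<Rightarrow> 'a \<Rightarrow> 'a"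
  where "glue_mult_AB A B a b \<phi> x y = x \<otimes>\<^bsub>A\<^esub> inv_into (glue_dom A a) \<phi> (y \<otimes>\<^bsub>B\<^esub> b)"

definition glue_mult :: "'a rlat \<Rightarrow> 'a rlat \<Rightarrow> 'a \<Rightarrow> 'a \<Rightarrow> ('a \<Rightarrow> 'a) \<Rightarrow> 'a \<Rightarrow> 'a \<Rightarrow> 'a"
  where "glue_mult A B a b \<phi> x y =
    (if x \<in> carrier A
     then (if y \<in> carrier A then x \<otimes>\<^bsub>A\<^esub> y else glue_mult_AB A B a b \<phi> x y)
     else (if y \<in> carrier A then glue_mult_AB A B a b \<phi> y x else x \<otimes>\<^bsub>B\<^esub> y))"

definition glue_join_AB :: "'a rlat \<Rightarrow> 'a rlat \<Rightarrow> 'a \<Rightarrow> 'a \<Rightarrow> ('a \<Rightarrow> 'a) \<Rightarrow> 'a \<Rightarrow> 'a \<Rightarrow> 'a"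
  where "glue_join_AB A B a b \<phi> x y =
    (if x \<preceq>\<^bsub>A\<^esub> \<sim>\<^bsub>A\<^esub> a
     then \<phi> (x \<curlyvee>\<^bsub>A\<^esub> a) \<curlyvee>\<^bsub>B\<^esub> y
     else x \<curlyvee>\<^bsub>A\<^esub> inv_into (glue_dom A a) \<phi> (y \<otimes>\<^bsub>B\<^esub> b))"

definition glue_join :: "'a rlat \<Rightarrow> 'a rlat \<Rightarrow> 'a \<Rightarrow> 'a \<Rightarrow> ('a \<Rightarrow> 'a) \<Rightarrow> 'a \<Rightarrow> 'a \<Rightarrow> 'a"
  where "glue_join A B a b \<phi> x y =
    (if x \<in> carrier A
     then (if y \<in> carrier A then x \<curlyvee>\<^bsub>A\<^esub> y else glue_join_AB A B a b \<phi> x y)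
     else (if y \<in> carrier A then glue_join_AB A B a b \<phi> y x else x \<curlyvee>\<^bsub>B\<^esub> y))"

definition gluing :: "'a rlat \<Rightarrow> 'a rlat \<Rightarrow> 'a \<Rightarrow> 'a \<Rightarrow> ('a \<Rightarrow> 'a) \<Rightarrow> 'a rlat"
  where "gluing A B a b \<phi> =
    \<lparr>carrier = carrier A \<union> carrier B,
     mult = glue_mult A B a b \<phi>,
     one = \<one>\<^bsub>B\<^esub>,
     rmeet = (\<lambda>x y. glue_neg A B (glue_join A B a b \<phi> (glue_neg A B x) (glue_neg A B y))),
     rjoin = glue_join A B a b \<phi>,
     rimp = (\<lambda>x y. glue_neg A B (glue_mult A B a b \<phi> (glue_neg A B y) x)),
     rzero = \<bbbO>\<^bsub>B\<^esub>\<rparr>"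

end

(* Multiplication and involution determine an involutive residuated lattice once the set N of
   elements below 0 is known: x <= y iff x * -y lies in N, and residuation and the antitonicity of
   the involution are then automatic. For the gluing, N is the union of the sets of elements below 0
   in A and in B. Writing P y for the inverse image of y * b under phi, the order between x in A and
   y in B becomes y <= x iff P y <= x, and x <= y iff x <= -P (-y). The latter condition is
   equivalent to x <= -a together with phi (x v a) <= y; this uses 0_b = phi (a v 0) and yields
   -P (-y) <= P y. Together with the fact that no P y lies below 0 (as a does not), this makes the
   relation a partial order, whose binary suprema are the joins of the gluing. *)

theory Submission
  imports Defs
begin

section \<open>Order, residuation and involution in a single algebra of the class\<close>

context CIdInRL
begin

lemma neg_closed [simp, intro]: "x \<in> carrier R \<Longrightarrow> \<sim> x \<in> carrier R"
  by (simp add: rneg_def imp_closed zero_closed)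

lemmas closed [simp] = meet_closed join_closed imp_closed zero_closed neg_neg

lemma leq_iff_join:
  assumes "x \<in> carrier R" "y \<in> carrier R"
  shows "x \<preceq> y \<longleftrightarrow> x \<curlyvee> y = y"
  using assms by (metis rleq_def join_comm join_meet_absorb meet_comm meet_join_absorb)

lemma leq_refl [simp]: "x \<in> carrier R \<Longrightarrow> x \<preceq> x"
  by (metis rleq_def join_meet_absorb meet_closed meet_join_absorb)

lemma leq_antisym: "\<lbrakk>x \<preceq> y; y \<preceq> x; x \<in> carrier R; y \<in> carrier R\<rbrakk> \<Longrightarrow> x = y"
  by (metis rleq_def meet_comm)

lemma leq_trans:
  "\<lbrakk>x \<preceq> y; y \<preceq> z; x \<in> carrier R; y \<in> carrier R; z \<in> carrier R\<rbrakk> \<Longrightarrow> x \<preceq> z"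
  by (metis rleq_def meet_assoc)

lemma join_upper1: "\<lbrakk>x \<in> carrier R; y \<in> carrier R\<rbrakk> \<Longrightarrow> x \<preceq> x \<curlyvee> y"
  by (simp add: rleq_def meet_join_absorb)

lemma join_upper2: "\<lbrakk>x \<in> carrier R; y \<in> carrier R\<rbrakk> \<Longrightarrow> y \<preceq> x \<curlyvee> y"
  by (metis join_comm join_upper1)

lemma join_leq_iff:
  assumes "x \<in> carrier R" "y \<in> carrier R" "z \<in> carrier R"
  shows "x \<curlyvee> y \<preceq> z \<longleftrightarrow> x \<preceq> z \<and> y \<preceq> z"
proof
  assume "x \<curlyvee> y \<preceq> z"
  then show "x \<preceq> z \<and> y \<preceq> z"
    using assms by (meson join_closed join_upper1 join_upper2 leq_trans)
next
  assume "x \<preceq> z \<and> y \<preceq> z"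
  then show "x \<curlyvee> y \<preceq> z"
    using assms by (simp add: leq_iff_join join_assoc)
qed

lemma meet_lower1: "\<lbrakk>x \<in> carrier R; y \<in> carrier R\<rbrakk> \<Longrightarrow> x \<curlywedge> y \<preceq> x"
  by (metis join_comm join_meet_absorb leq_iff_join meet_closed)

lemma meet_lower2: "\<lbrakk>x \<in> carrier R; y \<in> carrier R\<rbrakk> \<Longrightarrow> x \<curlywedge> y \<preceq> y"
  by (metis meet_comm meet_lower1)

lemma meet_greatest:
  "\<lbrakk>z \<preceq> x; z \<preceq> y; x \<in> carrier R; y \<in> carrier R; z \<in> carrier R\<rbrakk> \<Longrightarrow> z \<preceq> x \<curlywedge> y"
  by (metis rleq_def meet_assoc)

lemma mult_leq_zero_iff:
  "\<lbrakk>x \<in> carrier R; y \<in> carrier R\<rbrakk> \<Longrightarrow> x \<otimes> y \<preceq> \<bbbO> \<longleftrightarrow> x \<preceq> \<sim> y"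
  using residuation[of y x \<bbbO>] by (simp add: rneg_def m_comm)

lemma leq_iff_mult_neg:
  "\<lbrakk>x \<in> carrier R; y \<in> carrier R\<rbrakk> \<Longrightarrow> x \<preceq> y \<longleftrightarrow> x \<otimes> \<sim> y \<preceq> \<bbbO>"
  by (simp add: mult_leq_zero_iff)

lemma mult_neg_leq_zero: "x \<in> carrier R \<Longrightarrow> x \<otimes> \<sim> x \<preceq> \<bbbO>"
  by (simp add: mult_leq_zero_iff)

lemma neg_leq_neg_iff:
  "\<lbrakk>x \<in> carrier R; y \<in> carrier R\<rbrakk> \<Longrightarrow> \<sim> x \<preceq> \<sim> y \<longleftrightarrow> y \<preceq> x"
  by (metis leq_iff_mult_neg m_comm mult_leq_zero_iff neg_closed)

lemma neg_one: "\<sim> \<one> = \<bbbO>"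
proof (rule leq_antisym)
  show "\<sim> \<one> \<preceq> \<bbbO>" using mult_leq_zero_iff[of "\<sim> \<one>" \<one>] by simp
  show "\<bbbO> \<preceq> \<sim> \<one>" using mult_leq_zero_iff[of \<bbbO> \<one>] by simp
qed auto

lemma zero_leq_one: "\<bbbO> \<preceq> \<one>"
  by (simp add: leq_iff_mult_neg neg_one mult_idem)

lemma mult_mono:
  assumes "x \<preceq> y" "x \<in> carrier R" "y \<in> carrier R" "z \<in> carrier R"
  shows "x \<otimes> z \<preceq> y \<otimes> z"
proof -
  have "z \<otimes> y \<preceq> y \<otimes> z" using assms by (simp add: m_comm)
  then have "y \<preceq> z \<leadsto> y \<otimes> z" using assms by (simp add: residuation)
  then have "x \<preceq> z \<leadsto> y \<otimes> z" using assms by (meson closed(3) leq_trans m_closed)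
  then have "z \<otimes> x \<preceq> y \<otimes> z" using assms by (simp add: residuation)
  then show ?thesis using assms by (simp add: m_comm)
qed

lemma mult_leq_right:
  "\<lbrakk>x \<preceq> \<one>; x \<in> carrier R; y \<in> carrier R\<rbrakk> \<Longrightarrow> x \<otimes> y \<preceq> y"
  using mult_mono[of x \<one> y] by simp

text \<open>Residuation makes multiplication by \<open>z\<close> a lower adjoint, so it preserves
  binary joins.\<close>

lemma join_mult_distrib:
  assumes "x \<in> carrier R" "y \<in> carrier R" "z \<in> carrier R"
  shows "(x \<curlyvee> y) \<otimes> z = x \<otimes> z \<curlyvee> y \<otimes> z"
proof (rule leq_antisym)
  let ?t = "x \<otimes> z \<curlyvee> y \<otimes> z"
  have "z \<otimes> x \<preceq> ?t" "z \<otimes> y \<preceq> ?t"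
    using assms by (simp_all add: m_comm join_upper1 join_upper2)
  then have "x \<curlyvee> y \<preceq> z \<leadsto> ?t" using assms by (simp add: residuation join_leq_iff)
  then have "z \<otimes> (x \<curlyvee> y) \<preceq> ?t" using assms by (simp add: residuation)
  then show "(x \<curlyvee> y) \<otimes> z \<preceq> ?t" using assms by (simp add: m_comm)
  show "?t \<preceq> (x \<curlyvee> y) \<otimes> z"
    using assms by (simp add: join_leq_iff mult_mono join_upper1 join_upper2)
qed (use assms in auto)

text \<open>This is what gives access to the condition on 0_b: elements absorbing \<open>x\<close>
  cannot distinguish the zero of the algebra from the local zero 0_x. If w <= 0, then w <= 1, so w *
  (x * -x) <= x * -x <= 0; as w * x = w, this says w * -x <= 0, that is, w <= x. In both directions
  w <= -x is the same as w = w * x <= 0.\<close>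

lemma leq_zero_iff_leq_zero_at:
  assumes "x \<preceq> \<one>" "w \<otimes> x = w" and c: "x \<in> carrier R" "w \<in> carrier R"
  shows "w \<preceq> \<bbbO> \<longleftrightarrow> w \<preceq> zero_at R x"
proof
  assume w: "w \<preceq> \<bbbO>"
  then have "w \<preceq> \<one>" using c zero_leq_one leq_trans[of w \<bbbO> \<one>] by simp
  then have "w \<otimes> (x \<otimes> \<sim> x) \<preceq> x \<otimes> \<sim> x" using c by (simp add: mult_leq_right)
  then have "w \<otimes> (x \<otimes> \<sim> x) \<preceq> \<bbbO>"
    using c mult_neg_leq_zero[of x] leq_trans[of "w \<otimes> (x \<otimes> \<sim> x)" "x \<otimes> \<sim> x"] by simp
  then have "w \<otimes> \<sim> x \<preceq> \<bbbO>" using c assms(2) by (metis m_assoc neg_closed)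
  moreover have "w \<preceq> \<sim> x" using assms w by (simp flip: mult_leq_zero_iff)
  ultimately show "w \<preceq> zero_at R x"
    using c by (simp add: zero_at_def meet_greatest leq_iff_mult_neg[of w x])
next
  assume w: "w \<preceq> zero_at R x"
  then have "w \<preceq> \<sim> x"
    using c meet_lower2[of x "\<sim> x"] leq_trans[of w "x \<curlywedge> \<sim> x" "\<sim> x"]
    by (simp add: zero_at_def)
  then show "w \<preceq> \<bbbO>" using assms mult_leq_zero_iff[of w x] by simp
qed

end

section \<open>Recognising such an algebra from its monoid, involution and ideal\<close>

text \<open>The set \<open>N\<close> plays the role of the principal ideal of \<open>\<bbbO>\<close>, and \<open>n\<close> that of the involution.\<close>
lemma CIdInRL_of_involutive_monoid:
  fixes R :: "('a, 'm) rlat_scheme" (structure) and N :: "'a set" and n :: "'a \<Rightarrow> 'a"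
  defines "leq \<equiv> \<lambda>x y. x \<otimes> n y \<in> N"
  assumes monoid: "comm_monoid R"
    and idem: "\<And>x. x \<in> carrier R \<Longrightarrow> x \<otimes> x = x"
    and n_closed: "\<And>x. x \<in> carrier R \<Longrightarrow> n x \<in> carrier R"
    and n_n: "\<And>x. x \<in> carrier R \<Longrightarrow> n (n x) = x"
    and refl: "\<And>x. x \<in> carrier R \<Longrightarrow> leq x x"
    and antisym: "\<And>x y. \<lbrakk>x \<in> carrier R; y \<in> carrier R; leq x y; leq y x\<rbrakk> \<Longrightarrow> x = y"
    and trans: "\<And>x y z. \<lbrakk>x \<in> carrier R; y \<in> carrier R; z \<in> carrier R; leq x y; leq y z\<rbrakk>
      \<Longrightarrow> leq x z"
    and join: "\<And>x y. \<lbrakk>x \<in> carrier R; y \<in> carrier R\<rbrakk> \<Longrightarrow> x \<curlyvee> y \<in> carrier R"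
    and join_lub: "\<And>x y z. \<lbrakk>x \<in> carrier R; y \<in> carrier R; z \<in> carrier R\<rbrakk>
      \<Longrightarrow> leq (x \<curlyvee> y) z \<longleftrightarrow> leq x z \<and> leq y z"
    and meet: "\<And>x y. \<lbrakk>x \<in> carrier R; y \<in> carrier R\<rbrakk> \<Longrightarrow> x \<curlywedge> y = n (n x \<curlyvee> n y)"
    and imp: "\<And>x y. \<lbrakk>x \<in> carrier R; y \<in> carrier R\<rbrakk> \<Longrightarrow> x \<leadsto> y = n (n y \<otimes> x)"
    and zero: "\<bbbO> = n \<one>"
  shows "CIdInRL R"
proof -
  interpret comm_monoid R by fact
  note [simp] = n_closed n_n join meet imp
  have zero_c: "\<bbbO> \<in> carrier R" by (simp add: zero)
  have neg: "\<sim> x = n x" if "x \<in> carrier R" for x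
    using that zero_c by (simp add: rneg_def) (simp add: zero)
  have n_anti: "leq (n x) (n y) \<longleftrightarrow> leq y x" if "x \<in> carrier R" "y \<in> carrier R" for x y
    using that by (simp add: leq_def m_comm)
  have ub: "leq x (x \<curlyvee> y)" "leq y (x \<curlyvee> y)" if "x \<in> carrier R" "y \<in> carrier R" for x y
    using that join_lub[of x y "x \<curlyvee> y"] refl by auto
  \<comment> \<open>Elements with the same upper bounds are equal. With \<open>join_lub\<close> this
    reduces identities between joins to propositional logic.\<close>
  have eqI: "x = y" if "x \<in> carrier R" "y \<in> carrier R"
    "\<And>z. z \<in> carrier R \<Longrightarrow> leq x z \<longleftrightarrow> leq y z" for x y
    using that antisym refl by blast
  have jcomm: "x \<curlyvee> y = y \<curlyvee> x" if "x \<in> carrier R" "y \<in> carrier R" for x y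
    using that by (intro eqI) (auto simp: join_lub)
  have jassoc: "(x \<curlyvee> y) \<curlyvee> z = x \<curlyvee> (y \<curlyvee> z)"
    if "x \<in> carrier R" "y \<in> carrier R" "z \<in> carrier R" for x y z
    using that by (intro eqI) (auto simp: join_lub)
  have jabs: "x \<curlyvee> y = y" if "leq x y" "x \<in> carrier R" "y \<in> carrier R" for x y
    using that by (intro eqI) (auto simp: join_lub intro: trans[of x y])
  have mlb: "leq (n (n x \<curlyvee> n y)) x" if "x \<in> carrier R" "y \<in> carrier R" for x y
    using that ub(1)[of "n x" "n y"] n_anti[of "n x \<curlyvee> n y" "n x"] by simp
  have leq: "x \<preceq> y \<longleftrightarrow> leq x y" if c: "x \<in> carrier R" "y \<in> carrier R" for x y
  proof -
    \<comment> \<open>The order \<open>\<preceq>\<close> is defined by the meet, which is the De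
      Morgan dual of the join; applying \<open>n\<close> to both sides of the defining equation
      turns it into a statement about joins.\<close>
    have "x \<preceq> y \<longleftrightarrow> n x \<curlyvee> n y = n x"
      using c by (simp add: rleq_def) (metis join n_closed n_n)
    also have "\<dots> \<longleftrightarrow> leq (n y) (n x)"
      using c ub(2)[of "n x" "n y"] jabs[of "n y" "n x"] jcomm[of "n x" "n y"] by auto
    also have "\<dots> \<longleftrightarrow> leq x y" by (rule n_anti[OF c(2) c(1)])
    finally show ?thesis .
  qed
  show ?thesis
  proof unfold_locales
    fix x y assume c: "x \<in> carrier R" "y \<in> carrier R"
    show "x \<curlywedge> y = y \<curlywedge> x" using c jcomm by simp
    show "x \<curlywedge> (x \<curlyvee> y) = x"
      using c leq[of x "x \<curlyvee> y"] ub(1)[OF c] by (simp add: rleq_def)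
    show "x \<curlyvee> (x \<curlywedge> y) = x"
      using c jabs[OF mlb[OF c]] jcomm[of x "n (n x \<curlyvee> n y)"] by simp
    fix z assume z: "z \<in> carrier R"
    show "(x \<curlywedge> y) \<curlywedge> z = x \<curlywedge> (y \<curlywedge> z)" using c z jassoc by simp
    \<comment> \<open>Both sides unfold to the membership in \<open>N\<close> of one and the same
      product of \<open>x\<close>, \<open>y\<close> and \<open>n z\<close>.\<close>
    show "x \<otimes> y \<preceq> z \<longleftrightarrow> y \<preceq> x \<leadsto> z"
      using c z by (simp add: leq) (simp add: leq_def m_ac)
  qed (simp_all add: neg zero_c idem jassoc, simp add: jcomm)
qed

section \<open>The bijection \<open>\<phi>\<close> and the projection of B onto its domain\<close>

definition glue_proj :: "'a rlat \<Rightarrow> 'a rlat \<Rightarrow> 'a \<Rightarrow> 'a \<Rightarrow> ('a \<Rightarrow> 'a) \<Rightarrow> 'a \<Rightarrow> 'a"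
  where "glue_proj A B a b \<phi> y = inv_into (glue_dom A a) \<phi> (y \<otimes>\<^bsub>B\<^esub> b)"

definition glue_ideal :: "'a rlat \<Rightarrow> 'a rlat \<Rightarrow> 'a set"
  where "glue_ideal A B = {x \<in> carrier A. x \<preceq>\<^bsub>A\<^esub> \<bbbO>\<^bsub>A\<^esub>} \<union> {y \<in> carrier B. y \<preceq>\<^bsub>B\<^esub> \<bbbO>\<^bsub>B\<^esub>}"

definition glue_leq :: "'a rlat \<Rightarrow> 'a rlat \<Rightarrow> 'a \<Rightarrow> 'a \<Rightarrow> ('a \<Rightarrow> 'a) \<Rightarrow> 'a \<Rightarrow> 'a \<Rightarrow> bool"
  where "glue_leq A B a b \<phi> x y \<longleftrightarrow> glue_mult A B a b \<phi> x (glue_neg A B y) \<in> glue_ideal A B"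

context gluing_datum
begin

abbreviation P :: "'a \<Rightarrow> 'a" where "P \<equiv> glue_proj A B a b \<phi>"
abbreviation D :: "'a set" where "D \<equiv> glue_dom A a"

lemma a_closed [simp]: "a \<in> carrier A" and a_leq_one: "a \<preceq>\<^bsub>A\<^esub> \<one>\<^bsub>A\<^esub>"
  and b_closed [simp]: "b \<in> carrier B" and b_leq_one: "b \<preceq>\<^bsub>B\<^esub> \<one>\<^bsub>B\<^esub>"
  using a_neg b_neg by (auto simp: neg_cone_def)

lemma dom_iff: "x \<in> D \<longleftrightarrow> x \<in> carrier A \<and> a \<otimes>\<^bsub>A\<^esub> x = a"
  by (simp add: glue_dom_def mleq_def)

lemma a_in_dom [simp]: "a \<in> D" and one_in_dom [simp]: "\<one>\<^bsub>A\<^esub> \<in> D"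
  by (simp_all add: dom_iff A.mult_idem)

lemma mult_in_dom [simp]: "\<lbrakk>x \<in> D; y \<in> D\<rbrakk> \<Longrightarrow> x \<otimes>\<^bsub>A\<^esub> y \<in> D"
  by (simp add: dom_iff A.m_assoc[symmetric])

lemma join_in_dom [simp]: "\<lbrakk>x \<in> D; y \<in> D\<rbrakk> \<Longrightarrow> x \<curlyvee>\<^bsub>A\<^esub> y \<in> D"
  using A.join_mult_distrib[of x y a] A.leq_iff_join[of a a]
    A.m_comm[of a x] A.m_comm[of a y] A.m_comm[of a "x \<curlyvee>\<^bsub>A\<^esub> y"]
  by (simp add: dom_iff)

lemma dom_closed [simp]: "x \<in> D \<Longrightarrow> x \<in> carrier A"
  and a_mult_dom: "x \<in> D \<Longrightarrow> a \<otimes>\<^bsub>A\<^esub> x = a"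
  by (simp_all add: dom_iff)

lemma in_glue_cod_iff: "y \<in> glue_cod B b \<longleftrightarrow> y \<in> carrier B \<and> y \<otimes>\<^bsub>B\<^esub> b = y"
  by (simp add: glue_cod_def mleq_def)

lemma phi_closed [simp]: "x \<in> D \<Longrightarrow> \<phi> x \<in> carrier B"
  and phi_mult_b [simp]: "x \<in> D \<Longrightarrow> \<phi> x \<otimes>\<^bsub>B\<^esub> b = \<phi> x"
  using bij_betwE[OF phi_bij] in_glue_cod_iff[of "\<phi> x"] by simp_all

text \<open>As \<open>b\<close> is idempotent, multiplying by it moves all of B into the codomain of
  \<open>\<phi>\<close>. Hence the \<open>inv_into\<close> in \<open>glue_proj\<close> always picks
  a genuine preimage.\<close>

lemma mult_b_in_image:
  assumes "y \<in> carrier B"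
  shows "y \<otimes>\<^bsub>B\<^esub> b \<in> \<phi> ` D"
proof -
  have "y \<otimes>\<^bsub>B\<^esub> b \<in> glue_cod B b"
    using assms by (simp add: in_glue_cod_iff B.m_assoc B.mult_idem)
  then show ?thesis using bij_betw_imp_surj_on[OF phi_bij] by simp
qed

lemma proj_in_dom [simp]: "y \<in> carrier B \<Longrightarrow> P y \<in> D"
  and phi_proj [simp]: "y \<in> carrier B \<Longrightarrow> \<phi> (P y) = y \<otimes>\<^bsub>B\<^esub> b"
  unfolding glue_proj_def
  by (rule inv_into_into[OF mult_b_in_image], assumption)
    (rule f_inv_into_f[OF mult_b_in_image])

lemma proj_closed [simp]: "y \<in> carrier B \<Longrightarrow> P y \<in> carrier A"
  by simp

lemma phi_eq_iff: "\<lbrakk>x \<in> D; y \<in> D\<rbrakk> \<Longrightarrow> \<phi> x = \<phi> y \<longleftrightarrow> x = y"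
  using inj_on_eq_iff[OF bij_betw_imp_inj_on[OF phi_bij]] .

lemma phi_eqD: "\<lbrakk>\<phi> x = \<phi> y; x \<in> D; y \<in> D\<rbrakk> \<Longrightarrow> x = y"
  by (simp add: phi_eq_iff)

lemma proj_phi [simp]: "x \<in> D \<Longrightarrow> P (\<phi> x) = x"
  by (rule phi_eqD) simp_all

lemma proj_mult:
  assumes "y \<in> carrier B" "z \<in> carrier B"
  shows "P (y \<otimes>\<^bsub>B\<^esub> z) = P y \<otimes>\<^bsub>A\<^esub> P z"
proof (rule phi_eqD)
  have "(y \<otimes>\<^bsub>B\<^esub> b) \<otimes>\<^bsub>B\<^esub> (z \<otimes>\<^bsub>B\<^esub> b) = (y \<otimes>\<^bsub>B\<^esub> z) \<otimes>\<^bsub>B\<^esub> (b \<otimes>\<^bsub>B\<^esub> b)"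
    using assms by (simp add: B.m_ac)
  then show "\<phi> (P (y \<otimes>\<^bsub>B\<^esub> z)) = \<phi> (P y \<otimes>\<^bsub>A\<^esub> P z)"
    using assms by (simp add: phi_mult B.mult_idem)
qed (use assms in simp_all)

lemma proj_join:
  assumes "y \<in> carrier B" "z \<in> carrier B"
  shows "P (y \<curlyvee>\<^bsub>B\<^esub> z) = P y \<curlyvee>\<^bsub>A\<^esub> P z"
  by (rule phi_eqD) (use assms in \<open>simp_all add: phi_join B.join_mult_distrib\<close>)

lemma proj_one: "P \<one>\<^bsub>B\<^esub> = \<one>\<^bsub>A\<^esub>"
proof -
  \<comment> \<open>The image of the unit of B under \<open>P\<close> is the preimage of
    \<open>b\<close>, and \<open>b\<close> acts as a unit on the image of \<open>\<phi>\<close>. The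
    rule \<open>A.r_one\<close> is switched off so that the product survives until
    \<open>phi_mult\<close> can split it.\<close>
  have "\<phi> (P \<one>\<^bsub>B\<^esub> \<otimes>\<^bsub>A\<^esub> \<one>\<^bsub>A\<^esub>) = \<phi> \<one>\<^bsub>A\<^esub>"
    by (simp add: phi_mult B.m_comm[of b] del: A.r_one)
  from phi_eqD[OF this] show ?thesis by simp
qed

text \<open>The simplifier shortens the product of the unit of B with \<open>b\<close> to
  \<open>b\<close> before it can fold \<open>P\<close>; this form of \<open>proj_one\<close> serves
  the unit law of the gluing.\<close>

lemma inv_into_b: "inv_into D \<phi> b = \<one>\<^bsub>A\<^esub>"
  using proj_one by (simp add: glue_proj_def)

section \<open>Lattice order on the domain of \<open>\<phi>\<close>, and the two zeros\<close>

lemma phi_leq_iff: "\<lbrakk>x \<in> D; y \<in> D\<rbrakk> \<Longrightarrow> \<phi> x \<preceq>\<^bsub>B\<^esub> \<phi> y \<longleftrightarrow> x \<preceq>\<^bsub>A\<^esub> y"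
  by (simp add: A.leq_iff_join B.leq_iff_join phi_eq_iff flip: phi_join)

lemma proj_mono: "\<lbrakk>y \<preceq>\<^bsub>B\<^esub> z; y \<in> carrier B; z \<in> carrier B\<rbrakk> \<Longrightarrow> P y \<preceq>\<^bsub>A\<^esub> P z"
  by (simp add: B.mult_mono flip: phi_leq_iff)

text \<open>Here the monoidal order yields the lattice order. From a <= 1 follows a * (x * -x) <= x
  * -x <= 0, and a * x = a turns this into a * -x <= 0.\<close>

lemma a_leq_dom:
  assumes "x \<in> D"
  shows "a \<preceq>\<^bsub>A\<^esub> x"
proof -
  have "a \<otimes>\<^bsub>A\<^esub> (x \<otimes>\<^bsub>A\<^esub> \<sim>\<^bsub>A\<^esub> x) \<preceq>\<^bsub>A\<^esub> \<bbbO>\<^bsub>A\<^esub>"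
    using A.mult_leq_right[OF a_leq_one, of "x \<otimes>\<^bsub>A\<^esub> \<sim>\<^bsub>A\<^esub> x"] A.mult_neg_leq_zero[of x] assms
      A.leq_trans[of "a \<otimes>\<^bsub>A\<^esub> (x \<otimes>\<^bsub>A\<^esub> \<sim>\<^bsub>A\<^esub> x)"] by simp
  then show ?thesis
    using assms by (simp add: A.leq_iff_mult_neg[of a] a_mult_dom flip: A.m_assoc)
qed

lemma dom_not_leq_zero: "x \<in> D \<Longrightarrow> \<not> x \<preceq>\<^bsub>A\<^esub> \<bbbO>\<^bsub>A\<^esub>"
  using a_leq_dom a_not_below_zero A.leq_trans[of a x "\<bbbO>\<^bsub>A\<^esub>"] by auto

text \<open>Makes the first clause of the mixed join meaningful, where \<open>\<phi>\<close> is
  applied to x v a. One has x * a <= -a * a <= a, the last step because (-a * a) * -a = -a * a <= 0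
  by idempotence. Distributivity then gives a * (x v a) = a.\<close>

lemma join_a_in_dom:
  assumes "x \<in> carrier A" "x \<preceq>\<^bsub>A\<^esub> \<sim>\<^bsub>A\<^esub> a"
  shows "x \<curlyvee>\<^bsub>A\<^esub> a \<in> D"
proof -
  have "x \<otimes>\<^bsub>A\<^esub> a \<preceq>\<^bsub>A\<^esub> \<sim>\<^bsub>A\<^esub> a \<otimes>\<^bsub>A\<^esub> a"
    using assms by (simp add: A.mult_mono)
  moreover have "\<sim>\<^bsub>A\<^esub> a \<otimes>\<^bsub>A\<^esub> a \<preceq>\<^bsub>A\<^esub> a"
    using A.mult_neg_leq_zero[of a] by (simp add: A.leq_iff_mult_neg[of _ a] A.m_ac A.mult_idem)
  ultimately have "x \<otimes>\<^bsub>A\<^esub> a \<preceq>\<^bsub>A\<^esub> a"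
    using assms(1) A.leq_trans by (meson A.m_closed A.neg_closed a_closed)
  then have "a \<otimes>\<^bsub>A\<^esub> (x \<curlyvee>\<^bsub>A\<^esub> a) = a"
    using assms(1) A.join_mult_distrib[of x a a]
    by (simp add: A.leq_iff_join A.mult_idem A.m_comm[of a "x \<curlyvee>\<^bsub>A\<^esub> a"])
  then show ?thesis using assms(1) by (simp add: dom_iff del: dom_closed)
qed

text \<open>Values of \<open>\<phi>\<close> absorb \<open>b\<close>, so being below the zero of B
  means being below 0_b. The hypothesis \<open>zero_at_b\<close> and the order embedding
  \<open>\<phi>\<close> transport this to A.\<close>

lemma phi_leq_zero_iff:
  assumes "x \<in> D"
  shows "\<phi> x \<preceq>\<^bsub>B\<^esub> \<bbbO>\<^bsub>B\<^esub> \<longleftrightarrow> x \<preceq>\<^bsub>A\<^esub> a \<curlyvee>\<^bsub>A\<^esub> \<bbbO>\<^bsub>A\<^esub>"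
proof -
  have "\<bbbO>\<^bsub>A\<^esub> \<preceq>\<^bsub>A\<^esub> \<sim>\<^bsub>A\<^esub> a"
    using a_leq_one by (simp add: A.neg_leq_neg_iff flip: A.neg_one)
  then have "a \<curlyvee>\<^bsub>A\<^esub> \<bbbO>\<^bsub>A\<^esub> \<in> D"
    using join_a_in_dom[of "\<bbbO>\<^bsub>A\<^esub>"] by (simp add: A.join_comm)
  then show ?thesis
    using assms B.leq_zero_iff_leq_zero_at[of b "\<phi> x"]
    by (simp add: b_leq_one zero_at_b phi_leq_iff)
qed

text \<open>For the nontrivial direction, x <= a v 0 <= 1 gives x * 0 <= 0. With x * a <= 0,
  distributivity yields (a v 0) * x <= 0, while idempotence gives x = x * x <= (a v 0) * x.\<close>

lemma leq_zero_iff_leq_join: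
  assumes x: "x \<in> carrier A" and xa: "x \<otimes>\<^bsub>A\<^esub> a \<preceq>\<^bsub>A\<^esub> \<bbbO>\<^bsub>A\<^esub>"
  shows "x \<preceq>\<^bsub>A\<^esub> \<bbbO>\<^bsub>A\<^esub> \<longleftrightarrow> x \<preceq>\<^bsub>A\<^esub> a \<curlyvee>\<^bsub>A\<^esub> \<bbbO>\<^bsub>A\<^esub>"
proof
  assume "x \<preceq>\<^bsub>A\<^esub> \<bbbO>\<^bsub>A\<^esub>"
  then show "x \<preceq>\<^bsub>A\<^esub> a \<curlyvee>\<^bsub>A\<^esub> \<bbbO>\<^bsub>A\<^esub>"
    using x A.join_upper2[of a "\<bbbO>\<^bsub>A\<^esub>"] A.leq_trans[of x "\<bbbO>\<^bsub>A\<^esub>"] by simp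
next
  assume le: "x \<preceq>\<^bsub>A\<^esub> a \<curlyvee>\<^bsub>A\<^esub> \<bbbO>\<^bsub>A\<^esub>"
  have "a \<curlyvee>\<^bsub>A\<^esub> \<bbbO>\<^bsub>A\<^esub> \<preceq>\<^bsub>A\<^esub> \<one>\<^bsub>A\<^esub>"
    by (simp add: A.join_leq_iff a_leq_one A.zero_leq_one)
  then have "x \<preceq>\<^bsub>A\<^esub> \<one>\<^bsub>A\<^esub>" using le x A.leq_trans[of x "a \<curlyvee>\<^bsub>A\<^esub> \<bbbO>\<^bsub>A\<^esub>"] by simp
  then have "x \<otimes>\<^bsub>A\<^esub> \<bbbO>\<^bsub>A\<^esub> \<preceq>\<^bsub>A\<^esub> \<bbbO>\<^bsub>A\<^esub>" using x by (simp add: A.mult_leq_right)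
  then have "(a \<curlyvee>\<^bsub>A\<^esub> \<bbbO>\<^bsub>A\<^esub>) \<otimes>\<^bsub>A\<^esub> x \<preceq>\<^bsub>A\<^esub> \<bbbO>\<^bsub>A\<^esub>"
    using x xa by (simp add: A.join_mult_distrib A.join_leq_iff A.m_comm[of x])
  moreover have "x \<preceq>\<^bsub>A\<^esub> (a \<curlyvee>\<^bsub>A\<^esub> \<bbbO>\<^bsub>A\<^esub>) \<otimes>\<^bsub>A\<^esub> x"
    using A.mult_mono[OF le, of x] x by (simp add: A.mult_idem)
  ultimately show "x \<preceq>\<^bsub>A\<^esub> \<bbbO>\<^bsub>A\<^esub>"
    using x A.leq_trans[of x "(a \<curlyvee>\<^bsub>A\<^esub> \<bbbO>\<^bsub>A\<^esub>) \<otimes>\<^bsub>A\<^esub> x"] by simp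
qed

text \<open>Links the order obtained from the ideal (left) with the case distinction in the
  definition of the mixed join (right). The inequality in B is transported to A through
  \<open>phi_leq_zero_iff\<close>.\<close>

lemma leq_neg_proj_iff:
  assumes x: "x \<in> carrier A" and y: "y \<in> carrier B"
  shows "x \<preceq>\<^bsub>A\<^esub> \<sim>\<^bsub>A\<^esub> (P (\<sim>\<^bsub>B\<^esub> y)) \<longleftrightarrow>
    x \<preceq>\<^bsub>A\<^esub> \<sim>\<^bsub>A\<^esub> a \<and> \<phi> (x \<curlyvee>\<^bsub>A\<^esub> a) \<preceq>\<^bsub>B\<^esub> y" (is "?l \<longleftrightarrow> ?la \<and> ?r")
proof -
  let ?p = "P (\<sim>\<^bsub>B\<^esub> y)"
  have p: "?p \<in> D" using y by simp
  have "?l \<Longrightarrow> ?la"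
    using x p a_leq_dom[OF p] A.leq_trans[of x "\<sim>\<^bsub>A\<^esub> ?p" "\<sim>\<^bsub>A\<^esub> a"]
    by (simp add: A.neg_leq_neg_iff)
  moreover have "?l \<longleftrightarrow> ?r" if la: ?la
  proof -
    have d: "x \<curlyvee>\<^bsub>A\<^esub> a \<in> D" using x la by (rule join_a_in_dom)
    have "?r \<longleftrightarrow> \<phi> (x \<curlyvee>\<^bsub>A\<^esub> a) \<otimes>\<^bsub>B\<^esub> \<sim>\<^bsub>B\<^esub> y \<preceq>\<^bsub>B\<^esub> \<bbbO>\<^bsub>B\<^esub>"
      using d y by (intro B.leq_iff_mult_neg) auto
    also have "\<phi> (x \<curlyvee>\<^bsub>A\<^esub> a) \<otimes>\<^bsub>B\<^esub> \<sim>\<^bsub>B\<^esub> y = \<phi> (x \<curlyvee>\<^bsub>A\<^esub> a) \<otimes>\<^bsub>B\<^esub> b \<otimes>\<^bsub>B\<^esub> \<sim>\<^bsub>B\<^esub> y"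
      using d by simp
    also have "\<dots> = \<phi> ((x \<curlyvee>\<^bsub>A\<^esub> a) \<otimes>\<^bsub>A\<^esub> ?p)"
      using d y by (simp add: phi_mult B.m_ac del: phi_mult_b)
    also have "\<dots> \<preceq>\<^bsub>B\<^esub> \<bbbO>\<^bsub>B\<^esub> \<longleftrightarrow> (x \<curlyvee>\<^bsub>A\<^esub> a) \<otimes>\<^bsub>A\<^esub> ?p \<preceq>\<^bsub>A\<^esub> a \<curlyvee>\<^bsub>A\<^esub> \<bbbO>\<^bsub>A\<^esub>"
      using d p by (intro phi_leq_zero_iff) auto
    also have "(x \<curlyvee>\<^bsub>A\<^esub> a) \<otimes>\<^bsub>A\<^esub> ?p = x \<otimes>\<^bsub>A\<^esub> ?p \<curlyvee>\<^bsub>A\<^esub> a"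
      using x p by (simp add: A.join_mult_distrib a_mult_dom)
    also have "\<dots> \<preceq>\<^bsub>A\<^esub> a \<curlyvee>\<^bsub>A\<^esub> \<bbbO>\<^bsub>A\<^esub> \<longleftrightarrow> x \<otimes>\<^bsub>A\<^esub> ?p \<preceq>\<^bsub>A\<^esub> a \<curlyvee>\<^bsub>A\<^esub> \<bbbO>\<^bsub>A\<^esub>"
      using x p by (simp add: A.join_leq_iff A.join_upper1)
    also have "\<dots> \<longleftrightarrow> x \<otimes>\<^bsub>A\<^esub> ?p \<preceq>\<^bsub>A\<^esub> \<bbbO>\<^bsub>A\<^esub>"
    proof (rule leq_zero_iff_leq_join[symmetric])
      \<comment> \<open>Since \<open>?p\<close> lies in the domain, \<open>a\<close> absorbs it;
        what remains is x * a, which is below 0 because x <= -a.\<close>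
      have "x \<otimes>\<^bsub>A\<^esub> ?p \<otimes>\<^bsub>A\<^esub> a = x \<otimes>\<^bsub>A\<^esub> a"
        using x p by (simp add: a_mult_dom A.m_assoc A.m_comm[of ?p])
      then show "x \<otimes>\<^bsub>A\<^esub> ?p \<otimes>\<^bsub>A\<^esub> a \<preceq>\<^bsub>A\<^esub> \<bbbO>\<^bsub>A\<^esub>"
        using x la by (simp add: A.mult_leq_zero_iff)
    qed (use x p in simp)
    also have "\<dots> \<longleftrightarrow> ?l" using x p by (simp add: A.mult_leq_zero_iff)
    finally show ?thesis by simp
  qed
  ultimately show ?thesis by blast
qed

text \<open>Take x = -P (-y) itself in \<open>leq_neg_proj_iff\<close>: then phi (x v a) <= y, and
  applying the monotone \<open>P\<close>, which undoes \<open>\<phi>\<close>, gives x v a <= P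
  y.\<close>

lemma neg_proj_neg_leq_proj:
  assumes "y \<in> carrier B"
  shows "\<sim>\<^bsub>A\<^esub> (P (\<sim>\<^bsub>B\<^esub> y)) \<preceq>\<^bsub>A\<^esub> P y"
proof -
  let ?x = "\<sim>\<^bsub>A\<^esub> (P (\<sim>\<^bsub>B\<^esub> y))"
  have x: "?x \<in> carrier A" using assms by simp
  then have "?x \<preceq>\<^bsub>A\<^esub> \<sim>\<^bsub>A\<^esub> a" and le: "\<phi> (?x \<curlyvee>\<^bsub>A\<^esub> a) \<preceq>\<^bsub>B\<^esub> y"
    using leq_neg_proj_iff[OF x assms] by auto
  then have d: "?x \<curlyvee>\<^bsub>A\<^esub> a \<in> D" using x by (simp add: join_a_in_dom)
  then have "?x \<curlyvee>\<^bsub>A\<^esub> a \<preceq>\<^bsub>A\<^esub> P y" using proj_mono[OF le] assms by simp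
  then show ?thesis using x assms by (simp add: A.join_leq_iff)
qed

section \<open>The order relation on the union of the carriers\<close>

abbreviation leq :: "'a \<Rightarrow> 'a \<Rightarrow> bool" where "leq \<equiv> glue_leq A B a b \<phi>"

lemma in_B_not_in_A: "x \<in> carrier B \<Longrightarrow> x \<notin> carrier A"
  using disjoint by blast

lemmas glue_simps = glue_mult_def glue_mult_AB_def glue_neg_def in_B_not_in_A
  glue_proj_def[symmetric]

lemma glue_ideal_A: "x \<in> carrier A \<Longrightarrow> x \<in> glue_ideal A B \<longleftrightarrow> x \<preceq>\<^bsub>A\<^esub> \<bbbO>\<^bsub>A\<^esub>"
  and glue_ideal_B: "y \<in> carrier B \<Longrightarrow> y \<in> glue_ideal A B \<longleftrightarrow> y \<preceq>\<^bsub>B\<^esub> \<bbbO>\<^bsub>B\<^esub>"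
  using disjoint by (auto simp: glue_ideal_def)

lemma leq_AA: "\<lbrakk>x \<in> carrier A; y \<in> carrier A\<rbrakk> \<Longrightarrow> leq x y \<longleftrightarrow> x \<preceq>\<^bsub>A\<^esub> y"
  by (simp add: glue_leq_def glue_ideal_A glue_ideal_B glue_simps A.leq_iff_mult_neg[of x y])

lemma leq_BB: "\<lbrakk>x \<in> carrier B; y \<in> carrier B\<rbrakk> \<Longrightarrow> leq x y \<longleftrightarrow> x \<preceq>\<^bsub>B\<^esub> y"
  by (simp add: glue_leq_def glue_ideal_A glue_ideal_B glue_simps B.leq_iff_mult_neg[of x y])

lemma leq_AB: "\<lbrakk>x \<in> carrier A; y \<in> carrier B\<rbrakk> \<Longrightarrow> leq x y \<longleftrightarrow> x \<preceq>\<^bsub>A\<^esub> \<sim>\<^bsub>A\<^esub> (P (\<sim>\<^bsub>B\<^esub> y))"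
  by (simp add: glue_leq_def glue_ideal_A glue_ideal_B glue_simps A.mult_leq_zero_iff)

lemma leq_BA: "\<lbrakk>x \<in> carrier B; y \<in> carrier A\<rbrakk> \<Longrightarrow> leq x y \<longleftrightarrow> P x \<preceq>\<^bsub>A\<^esub> y"
  by (simp add: glue_leq_def glue_ideal_A glue_ideal_B glue_simps A.leq_iff_mult_neg[of "P x" y] A.m_comm)

lemmas leq_iffs = leq_AA leq_BB leq_AB leq_BA

text \<open>Otherwise P y * P z, an element of the domain of \<open>\<phi>\<close>, would lie below
  0. This rules out chains that start in B, pass through A and return to B.\<close>

lemma not_proj_leq_neg_proj:
  assumes "y \<in> carrier B" "z \<in> carrier B"
  shows "\<not> P y \<preceq>\<^bsub>A\<^esub> \<sim>\<^bsub>A\<^esub> (P z)"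
  using assms dom_not_leq_zero[of "P y \<otimes>\<^bsub>A\<^esub> P z"] by (simp add: A.mult_leq_zero_iff)

lemma leq_antisym:
  assumes "x \<in> carrier A \<union> carrier B" "y \<in> carrier A \<union> carrier B" "leq x y" "leq y x"
  shows "x = y"
proof -
  \<comment> \<open>A mixed pair is never comparable in both directions: that would give P v <= u <=
    -P (-v).\<close>
  have "\<not> (leq u v \<and> leq v u)" if "u \<in> carrier A" "v \<in> carrier B" for u v
    using that not_proj_leq_neg_proj[of v "\<sim>\<^bsub>B\<^esub> v"] A.leq_trans[of "P v" u "\<sim>\<^bsub>A\<^esub> (P (\<sim>\<^bsub>B\<^esub> v))"]
    by (auto simp: leq_iffs)
  then show ?thesis
    using assms A.leq_antisym B.leq_antisym by (auto simp: leq_iffs)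
qed

lemma leq_trans:
  assumes "x \<in> carrier A \<union> carrier B" "y \<in> carrier A \<union> carrier B" "z \<in> carrier A \<union> carrier B"
    and xy: "leq x y" and yz: "leq y z"
  shows "leq x z"
proof -
  let ?q = "\<lambda>y. \<sim>\<^bsub>A\<^esub> (P (\<sim>\<^bsub>B\<^esub> y))"
  have q_mono: "?q u \<preceq>\<^bsub>A\<^esub> ?q v" if "u \<preceq>\<^bsub>B\<^esub> v" "u \<in> carrier B" "v \<in> carrier B" for u v
    using that by (simp add: A.neg_leq_neg_iff B.neg_leq_neg_iff proj_mono)
  consider (A) "x \<in> carrier A" | (B) "x \<in> carrier B" using assms by auto
  then show ?thesis
  proof cases
    case A
    consider (AA) "y \<in> carrier A" "z \<in> carrier A" | (AB) "y \<in> carrier A" "z \<in> carrier B"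
      | (BA) "y \<in> carrier B" "z \<in> carrier A" | (BB) "y \<in> carrier B" "z \<in> carrier B"
      using assms by auto
    then show ?thesis
    proof cases
      case AA then show ?thesis using A xy yz A.leq_trans[of x y z] by (simp add: leq_iffs)
    next
      case AB then show ?thesis using A xy yz A.leq_trans[of x y "?q z"] by (simp add: leq_iffs)
    next
      case BA
      \<comment> \<open>The chain runs from A through B back to A; its two conditions meet at -P
        (-y) <= P y.\<close>
      then have "?q y \<preceq>\<^bsub>A\<^esub> z"
        using yz neg_proj_neg_leq_proj[of y] A.leq_trans[of "?q y" "P y" z] by (simp add: leq_iffs)
      then show ?thesis using BA A xy A.leq_trans[of x "?q y" z] by (simp add: leq_iffs)
    next
      case BB
      then show ?thesis using A xy yz q_mono A.leq_trans[of x "?q y" "?q z"] by (simp add: leq_iffs)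
    qed
  next
    case B
    consider (AA) "y \<in> carrier A" "z \<in> carrier A" | (AB) "y \<in> carrier A" "z \<in> carrier B"
      | (BA) "y \<in> carrier B" "z \<in> carrier A" | (BB) "y \<in> carrier B" "z \<in> carrier B"
      using assms by auto
    then show ?thesis
    proof cases
      case AA then show ?thesis using B xy yz A.leq_trans[of "P x" y z] by (simp add: leq_iffs)
    next
      case AB
      \<comment> \<open>This case is vacuous: no chain leads from B through A back to B.\<close>
      then have "P x \<preceq>\<^bsub>A\<^esub> ?q z"
        using B xy yz A.leq_trans[of "P x" y "?q z"] by (simp add: leq_iffs)
      then show ?thesis using B AB not_proj_leq_neg_proj by simp
    next
      case BA
      then show ?thesis
        using B xy yz proj_mono[of x y] A.leq_trans[of "P x" "P y" z] by (simp add: leq_iffs)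
    next
      case BB then show ?thesis using B xy yz B.leq_trans[of x y z] by (simp add: leq_iffs)
    qed
  qed
qed

section \<open>Binary suprema and the monoid of the gluing\<close>

lemma glue_join_AB_lub:
  assumes x: "x \<in> carrier A" and y: "y \<in> carrier B" and z: "z \<in> carrier A \<union> carrier B"
  shows "leq (glue_join_AB A B a b \<phi> x y) z \<longleftrightarrow> leq x z \<and> leq y z"
proof (cases "x \<preceq>\<^bsub>A\<^esub> \<sim>\<^bsub>A\<^esub> a")
  case True
  then have j: "glue_join_AB A B a b \<phi> x y = \<phi> (x \<curlyvee>\<^bsub>A\<^esub> a) \<curlyvee>\<^bsub>B\<^esub> y"
    by (simp add: glue_join_AB_def)
  have d: "x \<curlyvee>\<^bsub>A\<^esub> a \<in> D" using x True by (rule join_a_in_dom)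
  show ?thesis
  proof (cases "z \<in> carrier A")
    case zA: True
    \<comment> \<open>For \<open>z\<close> in A, bounding the join means x v a v P y <= z. The extra
      \<open>a\<close> costs nothing, because it lies below P y.\<close>
    have "a \<preceq>\<^bsub>A\<^esub> z" if "P y \<preceq>\<^bsub>A\<^esub> z"
      using that y zA a_leq_dom[of "P y"] A.leq_trans[of a "P y" z] by simp
    then show ?thesis
      using x y zA d by (auto simp: j leq_iffs proj_join A.join_leq_iff)
  next
    case False
    then show ?thesis
      using x y z d True by (auto simp: j leq_iffs B.join_leq_iff leq_neg_proj_iff)
  qed
next
  case False
  then have "glue_join_AB A B a b \<phi> x y = x \<curlyvee>\<^bsub>A\<^esub> P y"
    by (simp add: glue_join_AB_def glue_proj_def)
  \<comment> \<open>If x <= -a fails, then no element of B is above \<open>x\<close>, so only upper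
    bounds in A matter.\<close>
  moreover have "\<not> leq (x \<curlyvee>\<^bsub>A\<^esub> P y) z \<and> \<not> leq x z" if "z \<in> carrier B"
    using that x y False by (auto simp: leq_AB A.join_leq_iff leq_neg_proj_iff)
  ultimately show ?thesis
    using x y z by (auto simp: leq_iffs A.join_leq_iff)
qed

lemma glue_join_closed:
  "\<lbrakk>x \<in> carrier A \<union> carrier B; y \<in> carrier A \<union> carrier B\<rbrakk>
    \<Longrightarrow> glue_join A B a b \<phi> x y \<in> carrier A \<union> carrier B"
  by (auto simp: glue_join_def glue_join_AB_def join_a_in_dom in_B_not_in_A
      simp flip: glue_proj_def)

lemma glue_join_lub:
  assumes "x \<in> carrier A \<union> carrier B" "y \<in> carrier A \<union> carrier B" "z \<in> carrier A \<union> carrier B"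
  shows "leq (glue_join A B a b \<phi> x y) z \<longleftrightarrow> leq x z \<and> leq y z"
  using assms glue_join_AB_lub[of x y z] glue_join_AB_lub[of y x z]
  by (auto simp: glue_join_def leq_iffs in_B_not_in_A proj_join A.join_leq_iff B.join_leq_iff)

text \<open>The map \<open>P\<close> is a monoid homomorphism from B to A, and a mixed product is x
  * P y in A. The laws therefore reduce to those of the two monoids.\<close>

lemma comm_monoid_gluing: "comm_monoid (gluing A B a b \<phi>)"
proof unfold_locales
qed (auto simp: gluing_def glue_simps proj_mult proj_one inv_into_b A.m_ac B.m_ac)

lemma CIdInRL_gluing: "CIdInRL (gluing A B a b \<phi>)"
proof (rule CIdInRL_of_involutive_monoid[where N = "glue_ideal A B" and n = "glue_neg A B"])
  let ?G = "gluing A B a b \<phi>"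
  have carrier: "carrier ?G = carrier A \<union> carrier B" by (simp add: gluing_def)
  \<comment> \<open>Refolds the membership conditions of the criterion into the relation already
    shown to be an order with suprema.\<close>
  have leq: "x \<otimes>\<^bsub>?G\<^esub> glue_neg A B y \<in> glue_ideal A B \<longleftrightarrow> leq x y" for x y
    by (simp add: gluing_def glue_leq_def)
  have join: "x \<curlyvee>\<^bsub>?G\<^esub> y = glue_join A B a b \<phi> x y" for x y
    by (simp add: gluing_def)
  show "comm_monoid ?G" by (rule comm_monoid_gluing)
  fix x assume x: "x \<in> carrier ?G"
  show "x \<otimes>\<^bsub>?G\<^esub> x = x"
    using x by (auto simp: gluing_def glue_simps A.mult_idem B.mult_idem)
  show "glue_neg A B x \<in> carrier ?G" "glue_neg A B (glue_neg A B x) = x"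
    using x by (auto simp: gluing_def glue_simps)
  show "x \<otimes>\<^bsub>?G\<^esub> glue_neg A B x \<in> glue_ideal A B"
    using x by (auto simp: leq leq_iffs carrier)
  fix y assume y: "y \<in> carrier ?G"
  show "x \<curlyvee>\<^bsub>?G\<^esub> y \<in> carrier ?G"
    using x y by (simp only: join carrier glue_join_closed)
  show "x = y" if "x \<otimes>\<^bsub>?G\<^esub> glue_neg A B y \<in> glue_ideal A B"
    "y \<otimes>\<^bsub>?G\<^esub> glue_neg A B x \<in> glue_ideal A B"
    using that x y unfolding leq carrier by (simp add: leq_antisym)
  fix z assume z: "z \<in> carrier ?G"
  show "x \<otimes>\<^bsub>?G\<^esub> glue_neg A B z \<in> glue_ideal A B"
    if "x \<otimes>\<^bsub>?G\<^esub> glue_neg A B y \<in> glue_ideal A B" "y \<otimes>\<^bsub>?G\<^esub> glue_neg A B z \<in> glue_ideal A B"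
    using that x y z leq_trans unfolding leq carrier by blast
  show "(x \<curlyvee>\<^bsub>?G\<^esub> y) \<otimes>\<^bsub>?G\<^esub> glue_neg A B z \<in> glue_ideal A B \<longleftrightarrow>
    x \<otimes>\<^bsub>?G\<^esub> glue_neg A B z \<in> glue_ideal A B \<and> y \<otimes>\<^bsub>?G\<^esub> glue_neg A B z \<in> glue_ideal A B"
    using x y z glue_join_lub[of x y z] unfolding leq carrier join by simp
qed (auto simp: gluing_def glue_simps B.neg_one)

end

theorem theorem5p4:
  fixes A B :: "'a rlat" and a b :: 'a and \<phi> :: "'a \<Rightarrow> 'a"
  assumes "gluing_datum A B a b \<phi>"
  shows "CIdInRL (gluing A B a b \<phi>)"
  using assms by (rule gluing_datum.CIdInRL_gluing)

end
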